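(* Let $(X,T)$ be a Cantor minimal system of Toeplitz type of finite rank $d$ and let $\mu$ be a $T$-ergodic probability measure. Then all measurable eigenvalues of $(X,T,\mu)$ are rational, i.e. every eigenvalue of $(X,T,\mu)$ is of the form $\exp(2i\pi\alpha)$ with $\alpha\in\mathbb{Q}$.
   Context: A Cantor minimal system $(X,T)$ is a homeomorphism $T$ of a Cantor set $X$ all of whose orbits are dense. $\lambda\in\mathbb{C}$ is a (measurable) eigenvalue of $(X,T,\mu)$ if there is $f\in L^2(X,\mu)$, $f\ne0$, with $f\circ T=\lambda f$ $\mu$-a.e. Bratteli-Vershik representations. A Bratteli diagram is an infinite graph with vertex set $V=\bigsqcup_{n\ge0}V_n$ and edge set $E=\bigsqcup_{n\ge1}E_n$, all levels finite, $V_0=\{v_0\}$, $V_n=\{1,\dots,C(n)\}$ for $n\geq 1$; edges in $E_n$ go from $V_{n-1}$ (initial point) to $V_n$ (end-point); every vertex of $V_n$, $n\ge1$, is the end-point of an edge of $E_n$ and every vertex of $V_n$, $n\ge 0$, is the initial point of an edge of $E_{n+1}$. It is ordered by a partial order $\preceq$ on $E$ for which two edges are comparable iff they have the same end-point. $X_B$ is the compact space of infinite paths $(e_1,e_2,\dots)$, $e_n\in E_n$, starting at $v_0$, with basis the cylinder sets. The diagram is properly ordered if there is exactly one path $x_{\max}$ all of whose edges are maximal and exactly one path $x_{\min}$ all of whose edges are minimal. The Vershik map $V_B$ sends $x_{\max}$ to $x_{\min}$ and, for $x\ne x_{\max}$, if $k$ is least with $x_k$ not maximal, sends $x$ to $(y_1,\dots,y_{k-1},y_k,x_{k+1},\dots)$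 where $y_k$ is the successor of $x_k$ and $(y_1,\dots,y_{k-1})$ is the path of minimal edges from $v_0$ to the initial point of $y_k$. $(X,T)$ is given by $B$ if $B$ is properly ordered and $(X,T)=(X_B,V_B)$ up to conjugacy. Standing assumptions: there is at least one edge from each vertex of $V_{n-1}$ to each vertex of $V_n$ ($n\ge2$), and exactly one edge from $v_0$ to each vertex of $V_1$. The diagram is of Toeplitz type if for every $n\ge1$ the number of edges of $E_n$ ending at $u$ is the same for all $u\in V_n$. $(X,T)$ is of Toeplitz type of finite rank $d$ if it is given by a diagram of Toeplitz type with $C(n)\le d$ for all $n\ge1$. *)

theory Defs
  imports "HOL-Probability.Probability"
begin

definition cantor_set :: "'a topology \<Rightarrow> bool" where
  "cantor_set X \<longleftrightarrow>
     X homeomorphic_space product_topology (\<lambda>_::nat. discrete_topology (UNIV :: bool set)) UNIV"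

text \<open>The full orbit, over all integer iterates; backward iterates are expressed without an
  inverse function.\<close>

definition full_orbit :: "'a topology \<Rightarrow> ('a \<Rightarrow> 'a) \<Rightarrow> 'a \<Rightarrow> 'a set" where
  "full_orbit X T x = {y \<in> topspace X. \<exists>n. y = (T ^^ n) x \<or> (T ^^ n) y = x}"

definition cantor_minimal_system :: "'a topology \<Rightarrow> ('a \<Rightarrow> 'a) \<Rightarrow> bool" where
  "cantor_minimal_system X T \<longleftrightarrow>
     cantor_set X \<and> homeomorphic_map X X T \<and>
     (\<forall>x \<in> topspace X. X closure_of full_orbit X T x = topspace X)"

definition ergodic_probability :: "'a topology \<Rightarrow> ('a \<Rightarrow> 'a) \<Rightarrow> 'a measure \<Rightarrow> bool" where
  "ergodic_probability X T \<mu> \<longleftrightarrow>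
     prob_space \<mu> \<and>
     space \<mu> = topspace X \<and> sets \<mu> = sigma_sets (topspace X) {U. openin X U} \<and>
     T \<in> measurable \<mu> \<mu> \<and> distr \<mu> \<mu> T = \<mu> \<and>
     (\<forall>A \<in> sets \<mu>. T -` A \<inter> space \<mu> = A \<longrightarrow> measure \<mu> A = 0 \<or> measure \<mu> A = 1)"

definition measurable_eigenvalue :: "('a \<Rightarrow> 'a) \<Rightarrow> 'a measure \<Rightarrow> complex \<Rightarrow> bool" where
  "measurable_eigenvalue T \<mu> z \<longleftrightarrow>
     (\<exists>f \<in> borel_measurable \<mu>.
        integrable \<mu> (\<lambda>x. (cmod (f x))\<^sup>2) \<and>
        \<not> (AE x in \<mu>. f x = 0) \<and>
        (AE x in \<mu>. f (T x) = z * f x))"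

text \<open>
  The set \<open>edges n\<close> is used for \<open>n \<ge> 1\<close> only, and \<open>nverts 0\<close> is never used. A vertex is a pair of its level
  and its label, so that the vertex sets of different levels (and hence the edge sets of different
  levels) are disjoint; the top vertex is \<open>(0, 0)\<close>.
\<close>

record 'e bratteli =
  nverts :: "nat \<Rightarrow> nat"
  edges :: "nat \<Rightarrow> 'e set"
  src :: "'e \<Rightarrow> nat \<times> nat"
  tgt :: "'e \<Rightarrow> nat \<times> nat"
  ord_rel :: "('e \<times> 'e) set"

definition level :: "'e bratteli \<Rightarrow> nat \<Rightarrow> (nat \<times> nat) set" where
  "level B n = {n} \<times> (if n = 0 then {0} else {1..nverts B n})"

definition all_edges :: "'e bratteli \<Rightarrow> 'e set" where
  "all_edges B = (\<Union>n\<in>{1..}. edges B n)"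

definition bratteli_diagram :: "'e bratteli \<Rightarrow> bool" where
  "bratteli_diagram B \<longleftrightarrow>
     (\<forall>n\<ge>1. finite (edges B n) \<and>
        (\<forall>e \<in> edges B n. src B e \<in> level B (n - 1) \<and> tgt B e \<in> level B n) \<and>
        (\<forall>v \<in> level B n. \<exists>e \<in> edges B n. tgt B e = v)) \<and>
     (\<forall>n. \<forall>v \<in> level B n. \<exists>e \<in> edges B (n + 1). src B e = v)"

definition ordered_bratteli_diagram :: "'e bratteli \<Rightarrow> bool" where
  "ordered_bratteli_diagram B \<longleftrightarrow>
     bratteli_diagram B \<and>
     partial_order_on (all_edges B) (ord_rel B) \<and>
     (\<forall>e \<in> all_edges B. \<forall>f \<in> all_edges B.
        (e, f) \<in> ord_rel B \<or> (f, e) \<in> ord_rel B \<longleftrightarrow> tgt B e = tgt B f)"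

definition max_edge :: "'e bratteli \<Rightarrow> 'e \<Rightarrow> bool" where
  "max_edge B e \<longleftrightarrow> (\<forall>f. (e, f) \<in> ord_rel B \<longrightarrow> f = e)"

definition min_edge :: "'e bratteli \<Rightarrow> 'e \<Rightarrow> bool" where
  "min_edge B e \<longleftrightarrow> (\<forall>f. (f, e) \<in> ord_rel B \<longrightarrow> f = e)"

definition succ_edge :: "'e bratteli \<Rightarrow> 'e \<Rightarrow> 'e" where
  "succ_edge B e =
     (THE f. (e, f) \<in> ord_rel B \<and> f \<noteq> e \<and>
        (\<forall>g. (e, g) \<in> ord_rel B \<and> g \<noteq> e \<longrightarrow> (f, g) \<in> ord_rel B))"

text \<open>Paths are indexed from \<open>0\<close>: the value \<open>x i\<close> is the edge in \<open>edges (i + 1)\<close>.\<close>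

definition paths :: "'e bratteli \<Rightarrow> (nat \<Rightarrow> 'e) set" where
  "paths B = {x. \<forall>i. x i \<in> edges B (i + 1) \<and>
     src B (x i) = (if i = 0 then (0, 0) else tgt B (x (i - 1)))}"

definition cylinder :: "'e bratteli \<Rightarrow> nat \<Rightarrow> (nat \<Rightarrow> 'e) \<Rightarrow> (nat \<Rightarrow> 'e) set" where
  "cylinder B n p = {x \<in> paths B. \<forall>i<n. x i = p i}"

definition path_space :: "'e bratteli \<Rightarrow> (nat \<Rightarrow> 'e) topology" where
  "path_space B = topology_generated_by {cylinder B n p | n p. p \<in> paths B}"

definition properly_ordered :: "'e bratteli \<Rightarrow> bool" where
  "properly_ordered B \<longleftrightarrow>
     (\<exists>!x. x \<in> paths B \<and> (\<forall>i. max_edge B (x i))) \<and>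
     (\<exists>!x. x \<in> paths B \<and> (\<forall>i. min_edge B (x i)))"

definition min_path :: "'e bratteli \<Rightarrow> nat \<Rightarrow> 'e" where
  "min_path B = (THE x. x \<in> paths B \<and> (\<forall>i. min_edge B (x i)))"

definition vershik :: "'e bratteli \<Rightarrow> (nat \<Rightarrow> 'e) \<Rightarrow> nat \<Rightarrow> 'e" where
  "vershik B x =
     (if \<forall>i. max_edge B (x i) then min_path B
      else let k = (LEAST i. \<not> max_edge B (x i)) in
        THE y. y \<in> paths B \<and> (\<forall>i<k. min_edge B (y i)) \<and>
               y k = succ_edge B (x k) \<and> (\<forall>i>k. y i = x i))"

definition given_by :: "'a topology \<Rightarrow> ('a \<Rightarrow> 'a) \<Rightarrow> 'e bratteli \<Rightarrow> bool" where
  "given_by X T B \<longleftrightarrow>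
     ordered_bratteli_diagram B \<and> properly_ordered B \<and>
     (\<exists>h. homeomorphic_map (path_space B) X h \<and>
          (\<forall>x \<in> paths B. h (vershik B x) = T (h x)))"

definition standing_assumptions :: "'e bratteli \<Rightarrow> bool" where
  "standing_assumptions B \<longleftrightarrow>
     (\<forall>n\<ge>2. \<forall>u \<in> level B (n - 1). \<forall>v \<in> level B n. \<exists>e \<in> edges B n. src B e = u \<and> tgt B e = v) \<and>
     (\<forall>v \<in> level B 1. \<exists>!e. e \<in> edges B 1 \<and> src B e = (0, 0) \<and> tgt B e = v)"

definition toeplitz_diagram :: "'e bratteli \<Rightarrow> bool" where
  "toeplitz_diagram B \<longleftrightarrow>
     (\<forall>n\<ge>1. \<forall>u \<in> level B n. \<forall>v \<in> level B n.
        card {e \<in> edges B n. tgt B e = u} = card {e \<in> edges B n. tgt B e = v})"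

text \<open>The first argument names the type from which the edges of the diagram are drawn, since a
  definition cannot quantify over types.\<close>

definition toeplitz_type_of_rank :: "'e itself \<Rightarrow> 'a topology \<Rightarrow> ('a \<Rightarrow> 'a) \<Rightarrow> nat \<Rightarrow> bool" where
  "toeplitz_type_of_rank (_ :: 'e itself) X T d \<longleftrightarrow>
     (\<exists>B :: 'e bratteli. given_by X T B \<and> standing_assumptions B \<and> toeplitz_diagram B \<and>
        (\<forall>n\<ge>1. nverts B n \<le> d))"

end

theory Submission
  imports Defs
begin

text \<open>Since all vertices of level \<open>n\<close> have the same height \<open>h\<close>, the rank of a path among the
  paths with the same vertex at level \<open>n\<close> increases by 1 modulo \<open>h\<close> under the Vershik map.
  Hence each set \<open>D\<close> of points of a given rank is invariant under the \<open>h\<close>-th iterate of \<open>T\<close>, and it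
  meets at most \<open>d\<close> cylinders of length \<open>n\<close>. Let \<open>g\<close> be an eigenfunction with values of modulus 0
  or 1, and suppose that the eigenvalue is not a root of unity. Invariance of \<open>D\<close> gives
  \<open>\<integral>\<^sub>D g^k cnj(g)^m = 0\<close> for \<open>k < m\<close>. Approximate \<open>g\<close> in \<open>L^1\<close> by a function \<open>\<psi>\<close> that is constant
  on cylinders of length \<open>n\<close>, and let \<open>P\<close> be the monic polynomial of degree \<open>m \<le> d\<close> whose roots are the
  values of \<open>\<psi>\<close> on \<open>D\<close>. Then
  \<open>\<mu>(D \<inter> {g \<noteq> 0}) = \<integral>\<^sub>D P(g) cnj(g)^m \<le> 3^d \<integral>\<^sub>D |g - \<psi>|\<close>,
  and summing over the ranks shows that \<open>\<mu>{g \<noteq> 0}\<close> is arbitrarily small.\<close>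

section \<open>Approximation by functions constant on cylinders\<close>

text \<open>\<open>code n x\<close> names the cell of \<open>x\<close> in the n-th of a sequence of
  finite, successively finer partitions that generate the sigma-algebra. In the application the
  cells are the cylinders of length \<open>n\<close>.\<close>

locale refining_codes = prob_space M for M :: "'a measure" +
  fixes code :: "nat \<Rightarrow> 'a \<Rightarrow> 'c"
  assumes finite_codes: "finite (code n ` space M)"
    and refine: "\<lbrakk>m \<le> n; x \<in> space M; y \<in> space M; code n x = code n y\<rbrakk> \<Longrightarrow> code m x = code m y"
    and sets_eq: "sets M = sigma_sets (space M) {{x \<in> space M. code n x \<in> C} | n C. True}"
begin

lemma code_measurable [measurable]: "code n \<in> measurable M (count_space UNIV)"
proof (rule measurableI)
  fix C :: "'c set"
  have "code n -` C \<inter> space M = {x \<in> space M. code n x \<in> C}" by auto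
  also have "\<dots> \<in> sets M" unfolding sets_eq by (rule sigma_sets.Basic) auto
  finally show "code n -` C \<inter> space M \<in> sets M" .
qed simp

lemma code_fun_measurable [measurable]:
  fixes \<phi> :: "'c \<Rightarrow> 'b::topological_space"
  shows "(\<lambda>x. \<phi> (code n x)) \<in> borel_measurable M"
  by (rule measurable_compose[OF code_measurable]) simp

lemma code_fun_integrable [simp]:
  fixes \<phi> :: "'c \<Rightarrow> complex"
  shows "integrable M (\<lambda>x. \<phi> (code n x))"
proof -
  have "bounded (\<phi> ` code n ` space M)"
    using finite_codes by (intro finite_imp_bounded) simp
  then obtain K where "\<And>x. x \<in> space M \<Longrightarrow> norm (\<phi> (code n x)) \<le> K"
    unfolding bounded_iff by blast
  then show ?thesis
    by (intro integrable_const_bound[where B = K]) auto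
qed

text \<open>The coarser code is constant on every cell of the finer one, so it may be evaluated at a
  chosen point of the cell. This brings functions from different levels to a common level.\<close>

lemma refined_fun:
  assumes "m \<le> n"
  obtains \<psi> where "\<And>x. x \<in> space M \<Longrightarrow> \<phi> (code m x) = \<psi> (code n x)"
proof
  fix x assume x: "x \<in> space M"
  let ?y = "SOME y. y \<in> space M \<and> code n y = code n x"
  have "?y \<in> space M \<and> code n ?y = code n x"
    by (rule someI[where x = x]) (simp add: x)
  then show "\<phi> (code m x) = (\<lambda>c. \<phi> (code m (SOME y. y \<in> space M \<and> code n y = c))) (code n x)"
    using refine[OF assms x, of ?y] by auto
qed

text \<open>Membership in the L^1 closure of the functions constant on cells. Integrability is
  included because the integral of a non-integrable function is 0 by convention.\<close>

definition approximable :: "('a \<Rightarrow> complex) \<Rightarrow> bool" where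
  "approximable f \<longleftrightarrow> integrable M f \<and>
     (\<forall>\<epsilon>>0. \<exists>n \<phi>. (\<integral>x. norm (f x - \<phi> (code n x)) \<partial>M) < \<epsilon>)"

lemma approximableE:
  assumes "approximable f" "\<epsilon> > 0"
  obtains n \<phi> where "(\<integral>x. norm (f x - \<phi> (code n x)) \<partial>M) < \<epsilon>"
  using assms unfolding approximable_def by blast

lemma approximable_code: "approximable (\<lambda>x. \<phi> (code n x))"
  unfolding approximable_def
  by (auto intro!: exI[of _ n] exI[of _ \<phi>])

lemma approximable_cong:
  assumes "approximable f" "\<And>x. x \<in> space M \<Longrightarrow> f x = g x"
  shows "approximable g"
proof -
  have "integrable M g \<longleftrightarrow> integrable M f" by (rule Bochner_Integration.integrable_cong) (auto simp: assms)
  moreover have "(\<integral>x. norm (g x - \<phi> (code n x)) \<partial>M) = (\<integral>x. norm (f x - \<phi> (code n x)) \<partial>M)" for \<phi> n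
    by (rule Bochner_Integration.integral_cong) (auto simp: assms)
  ultimately show ?thesis using assms(1) by (simp add: approximable_def)
qed

lemma approximable_scale:
  assumes f: "approximable f"
  shows "approximable (\<lambda>x. c * f x)"
proof (cases "c = 0")
  case True
  then show ?thesis using approximable_code[of "\<lambda>_. 0"] by simp
next
  case False
  have "\<exists>n \<phi>. (\<integral>x. norm (c * f x - \<phi> (code n x)) \<partial>M) < \<epsilon>" if eps: "\<epsilon> > 0" for \<epsilon>
  proof -
    obtain n \<phi> where *: "(\<integral>x. norm (f x - \<phi> (code n x)) \<partial>M) < \<epsilon> / norm c"
      by (rule approximableE[OF f, of "\<epsilon> / norm c"]) (use False eps in auto)
    have "(\<integral>x. norm (c * f x - c * \<phi> (code n x)) \<partial>M) = (\<integral>x. norm c * norm (f x - \<phi> (code n x)) \<partial>M)"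
      by (simp flip: right_diff_distrib norm_mult)
    also have "\<dots> = norm c * (\<integral>x. norm (f x - \<phi> (code n x)) \<partial>M)" by simp
    also have "\<dots> < \<epsilon>" using * False by (simp add: field_simps)
    finally show ?thesis by (intro exI[of _ n] exI[of _ "\<lambda>z. c * \<phi> z"]) simp
  qed
  then show ?thesis using f by (auto simp: approximable_def)
qed

lemma approximable_add:
  assumes f: "approximable f" and g: "approximable g"
  shows "approximable (\<lambda>x. f x + g x)"
proof -
  have [simp]: "integrable M f" "integrable M g" using f g by (auto simp: approximable_def)
  have "\<exists>n \<phi>. (\<integral>x. norm (f x + g x - \<phi> (code n x)) \<partial>M) < \<epsilon>" if eps: "\<epsilon> > 0" for \<epsilon>
  proof -
    obtain n \<phi> where 1: "(\<integral>x. norm (f x - \<phi> (code n x)) \<partial>M) < \<epsilon> / 2"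
      by (rule approximableE[OF f half_gt_zero[OF eps]])
    obtain m \<psi> where 2: "(\<integral>x. norm (g x - \<psi> (code m x)) \<partial>M) < \<epsilon> / 2"
      by (rule approximableE[OF g half_gt_zero[OF eps]])
    define k where "k = max n m"
    obtain \<phi>' where \<phi>': "\<And>x. x \<in> space M \<Longrightarrow> \<phi> (code n x) = \<phi>' (code k x)"
      using refined_fun[of n k] by (auto simp: k_def)
    obtain \<psi>' where \<psi>': "\<And>x. x \<in> space M \<Longrightarrow> \<psi> (code m x) = \<psi>' (code k x)"
      using refined_fun[of m k] by (auto simp: k_def)
    have "(\<integral>x. norm (f x + g x - (\<phi>' (code k x) + \<psi>' (code k x))) \<partial>M)
       \<le> (\<integral>x. norm (f x - \<phi> (code n x)) + norm (g x - \<psi> (code m x)) \<partial>M)"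
      by (intro integral_mono) (auto simp flip: \<phi>' \<psi>' intro!: norm_diff_triangle_ineq)
    also have "\<dots> < \<epsilon>" using 1 2 by (subst Bochner_Integration.integral_add) auto
    finally show ?thesis by (intro exI[of _ k] exI[of _ "\<lambda>c. \<phi>' c + \<psi>' c"])
  qed
  then show ?thesis by (auto simp: approximable_def)
qed

lemma approximable_sum:
  assumes "\<And>i. i \<in> I \<Longrightarrow> approximable (f i)"
  shows "approximable (\<lambda>x. \<Sum>i\<in>I. f i x)"
  using assms
proof (induction I rule: infinite_finite_induct)
  case (insert i I)
  then show ?case using approximable_add[of "f i" "\<lambda>x. \<Sum>i\<in>I. f i x"] by simp
qed (use approximable_code[of "\<lambda>_. 0"] in simp_all)

text \<open>Dominated convergence turns the pointwise limit into a limit in L^1; it then suffices to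
  approximate a late \<open>s i\<close>.\<close>

lemma approximable_lim:
  fixes s :: "nat \<Rightarrow> 'a \<Rightarrow> complex"
  assumes s: "\<And>i. approximable (s i)"
    and lim: "\<And>x. x \<in> space M \<Longrightarrow> (\<lambda>i. s i x) \<longlonglongrightarrow> f x"
    and bound: "\<And>i x. x \<in> space M \<Longrightarrow> norm (s i x) \<le> w x"
    and f: "integrable M f" and w: "integrable M w"
  shows "approximable f"
proof -
  have [simp]: "integrable M (s i)" for i using s by (auto simp: approximable_def)
  note f [simp]
  have [measurable]: "f \<in> borel_measurable M" "s i \<in> borel_measurable M" for i
    by (auto intro: borel_measurable_integrable)
  have "(\<lambda>i. \<integral>x. norm (f x - s i x) \<partial>M) \<longlonglongrightarrow> (\<integral>x. 0 \<partial>M)"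
  proof (rule integral_dominated_convergence[where w = "\<lambda>x. norm (f x) + w x"])
    show "AE x in M. (\<lambda>i. norm (f x - s i x)) \<longlonglongrightarrow> 0"
      using lim by (intro AE_I2 tendsto_eq_intros) auto
    show "AE x in M. norm (norm (f x - s i x)) \<le> norm (f x) + w x" for i
      using bound by (intro AE_I2) (auto intro!: order_trans[OF norm_triangle_ineq4])
  qed (use w in auto)
  then have to0: "(\<lambda>i. \<integral>x. norm (f x - s i x) \<partial>M) \<longlonglongrightarrow> 0" by simp
  have "\<exists>n \<phi>. (\<integral>x. norm (f x - \<phi> (code n x)) \<partial>M) < \<epsilon>" if eps: "\<epsilon> > 0" for \<epsilon>
  proof -
    obtain i where 1: "(\<integral>x. norm (f x - s i x) \<partial>M) < \<epsilon> / 2"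
      using eventually_happens[OF order_tendstoD(2)[OF to0 half_gt_zero[OF eps]]] by auto
    obtain n \<phi> where 2: "(\<integral>x. norm (s i x - \<phi> (code n x)) \<partial>M) < \<epsilon> / 2"
      by (rule approximableE[OF s half_gt_zero[OF eps]])
    have "(\<integral>x. norm (f x - \<phi> (code n x)) \<partial>M)
       \<le> (\<integral>x. norm (f x - s i x) + norm (s i x - \<phi> (code n x)) \<partial>M)"
    proof (intro integral_mono)
      show "norm (f x - \<phi> (code n x)) \<le> norm (f x - s i x) + norm (s i x - \<phi> (code n x))" for x
        using norm_triangle_ineq[of "f x - s i x" "s i x - \<phi> (code n x)"] by simp
    qed auto
    also have "\<dots> < \<epsilon>" using 1 2 by (subst Bochner_Integration.integral_add) auto
    finally show ?thesis by blast
  qed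
  then show ?thesis using f by (auto simp: approximable_def)
qed

text \<open>Two conditions on codes can be read at a common finer level, so the generators are
  stable under intersection; the sets with approximable indicator form a Dynkin system.\<close>

lemma approximable_indicator:
  assumes A: "A \<in> sets M"
  shows "approximable (indicator A)"
proof -
  let ?G = "{{x \<in> space M. code n x \<in> C} | n C. True}"
  have "Int_stable ?G"
  proof (rule Int_stableI)
    fix a b assume "a \<in> ?G" "b \<in> ?G"
    then obtain n C m D where a: "a = {x \<in> space M. code n x \<in> C}" and b: "b = {x \<in> space M. code m x \<in> D}"
      by auto
    define k where "k = max n m"
    obtain \<phi> where \<phi>: "\<And>x. x \<in> space M \<Longrightarrow> (code n x \<in> C) = \<phi> (code k x)"
      using refined_fun[of n k "\<lambda>c. c \<in> C"] by (auto simp: k_def)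
    obtain \<psi> where \<psi>: "\<And>x. x \<in> space M \<Longrightarrow> (code m x \<in> D) = \<psi> (code k x)"
      using refined_fun[of m k "\<lambda>c. c \<in> D"] by (auto simp: k_def)
    have "a \<inter> b = {x \<in> space M. code k x \<in> {c. \<phi> c \<and> \<psi> c}}"
      using \<phi> \<psi> by (auto simp: a b)
    then show "a \<inter> b \<in> ?G" by blast
  qed
  moreover have "?G \<subseteq> Pow (space M)" by auto
  moreover have "A \<in> sigma_sets (space M) ?G" using A by (simp add: sets_eq)
  ultimately show ?thesis
  proof (induction rule: sigma_sets_induct_disjoint)
    case (basic A)
    then obtain n C where A: "A = {x \<in> space M. code n x \<in> C}" by auto
    show ?case
      by (rule approximable_cong[OF approximable_code[of "indicator C" n]])
        (auto simp: A indicator_def)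
  next
    case empty
    show ?case using approximable_code[of "\<lambda>_. 0"] by (simp add: indicator_def)
  next
    case (compl A)
    show ?case
      by (rule approximable_cong[OF approximable_add[OF approximable_code[of "\<lambda>_. 1" 0]
            approximable_scale[OF compl(2), of "-1"]]])
        (auto simp: indicator_def)
  next
    case (union A)
    note disj = union(1)
    have meas: "A i \<in> sets M" for i using union(2) by (auto simp: sets_eq)
    \<comment> \<open>Disjointness turns partial sums into indicators of partial unions, so they are
      bounded by 1 and \<open>approximable_lim\<close> applies.\<close>
    have fin: "(\<Sum>i<k. indicator (A i) x) = (indicator (\<Union>i<k. A i) x :: complex)" for x and k :: nat
      using disj by (subst indicator_UN_disjoint) (auto simp: disjoint_family_on_def)
    show ?case
    proof (rule approximable_lim[where s = "\<lambda>k x. \<Sum>i<k. indicator (A i) x" and w = "\<lambda>_. 1"])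
      show "approximable (\<lambda>x. \<Sum>i<k. indicator (A i) x)" for k
        by (rule approximable_sum) (use union(3) in auto)
      show "(\<lambda>k. \<Sum>i<k. indicator (A i) x) \<longlonglongrightarrow> (indicator (\<Union>i. A i) x :: complex)" for x
        unfolding fin by (rule LIMSEQ_indicator_UN)
      show "norm (\<Sum>i<k. indicator (A i) x :: complex) \<le> 1" for k x
        unfolding fin by (simp add: indicator_def)
      have "(\<Union>i. A i) \<in> sets M" using meas by auto
      then show "integrable M (indicator (\<Union>i. A i) :: 'a \<Rightarrow> complex)"
        by (intro integrable_const_bound[where B = 1]) (auto simp: indicator_def)
    qed auto
  qed
qed

lemma integrable_approximable:
  assumes "integrable M f"
  shows "approximable f"
  using assms
proof (induction rule: integrable_induct)
  case (base A c)
  show ?case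
    by (rule approximable_cong[OF approximable_scale[OF approximable_indicator[OF base(1)], of c]])
      (auto simp: indicator_def)
next
  case (add f g)
  then show ?case by (simp add: approximable_add)
next
  case (lim f s)
  show ?case
    by (rule approximable_lim[where s = s and w = "\<lambda>x. 2 * norm (f x)"]) (simp_all add: lim)
qed

end

section \<open>Eigenfunctions of measure-preserving maps\<close>

lemma borel_measurable_cnj [measurable]: "cnj \<in> borel_measurable borel"
  by (intro borel_measurable_continuous_onI continuous_intros)

lemma measure_preserving_funpow:
  assumes T: "T \<in> measurable M M" "distr M M T = M"
  shows "T ^^ n \<in> measurable M M \<and> distr M M (T ^^ n) = M"
proof (induction n)
  case 0
  show ?case using distr_id2[of M M] by (auto simp: id_def)
next
  case (Suc n)
  have "distr M M (T ^^ Suc n) = distr (distr M M (T ^^ n)) M T"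
    unfolding funpow.simps using Suc T(1) by (intro distr_distr[symmetric]) auto
  also have "\<dots> = M" using Suc T(2) by metis
  finally have "distr M M (T ^^ Suc n) = M" .
  moreover have "T ^^ Suc n \<in> measurable M M"
    unfolding funpow.simps using measurable_comp[of "T ^^ n" M M T M] Suc T(1) by blast
  ultimately show ?case by blast
qed

lemma AE_funpow:
  assumes T: "T \<in> measurable M M" "distr M M T = M" and P: "AE x in M. P x"
  shows "AE x in M. P ((T ^^ n) x)"
proof -
  note Tn = measure_preserving_funpow[OF T, of n]
  have "AE x in distr M M (T ^^ n). P x" using P Tn by metis
  then show ?thesis using Tn by (intro AE_distrD[where M = M and M' = M]) auto
qed

lemma eigenfunction_funpow:
  fixes g :: "'a \<Rightarrow> complex"
  assumes T: "T \<in> measurable M M" "distr M M T = M" and g: "AE x in M. g (T x) = z * g x"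
  shows "AE x in M. g ((T ^^ n) x) = z ^ n * g x"
proof (induction n)
  case (Suc n)
  show ?case using Suc AE_funpow[OF T g, of n] by eventually_elim simp
qed simp

text \<open>Both sides of the equation g((T^N) x) = z^N g(x) are integrated over an invariant set;
  the two exponents differ, so the factor picked up is not 1 unless z is a root of unity.\<close>

lemma (in finite_measure) eigenfunction_moment_eq_0:
  fixes g :: "'a \<Rightarrow> complex"
  assumes T: "T \<in> measurable M M" "distr M M T = M"
    and g [measurable]: "g \<in> borel_measurable M"
    and eig: "AE x in M. g (T x) = z * g x" and z: "norm z = 1"
    and D [measurable]: "D \<in> sets M" and inv: "\<And>x. x \<in> space M \<Longrightarrow> (T ^^ N) x \<in> D \<longleftrightarrow> x \<in> D"
    and nroot: "z ^ (N * (m - k)) \<noteq> 1" and "k \<le> m"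
  shows "(\<integral>x. indicator D x * (g x ^ k * cnj (g x) ^ m) \<partial>M) = 0"
proof -
  define u where "u x = indicator D x * (g x ^ k * cnj (g x) ^ m)" for x
  have [measurable]: "u \<in> borel_measurable M" unfolding u_def by measurable
  define c where "c = cnj (z ^ (N * (m - k)))"
  \<comment> \<open>As \<open>norm z = 1\<close>, the common powers of \<open>z\<close> and
    \<open>cnj z\<close> cancel, and only the excess \<open>m - k\<close> of conjugate factors
    survives.\<close>
  have unit: "z ^ (N * k) * cnj z ^ (N * k) = 1"
    using z by (simp flip: power_mult_distrib add: complex_norm_square[symmetric])
  have c: "(z ^ N) ^ k * cnj (z ^ N) ^ m = c"
  proof -
    have "(z ^ N) ^ k * cnj (z ^ N) ^ m = z ^ (N * k) * cnj z ^ (N * k + N * (m - k))"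
      using \<open>k \<le> m\<close> by (simp flip: power_mult distrib_left)
    also have "\<dots> = c" using unit by (simp add: power_add c_def)
    finally show ?thesis .
  qed
  have TN: "T ^^ N \<in> measurable M M" "distr M M (T ^^ N) = M"
    using measure_preserving_funpow[OF T, of N] by auto
  have "(\<integral>x. u x \<partial>M) = (\<integral>x. u ((T ^^ N) x) \<partial>M)"
    using integral_distr[OF TN(1), of u] TN(2) by simp
  also have "\<dots> = (\<integral>x. c * u x \<partial>M)"
  proof (rule integral_cong_AE)
    show "(\<lambda>x. u ((T ^^ N) x)) \<in> borel_measurable M"
      using TN(1) by (rule measurable_compose) simp
    show "AE x in M. u ((T ^^ N) x) = c * u x"
      using eigenfunction_funpow[OF T eig, of N] AE_space
    proof eventually_elim
      case (elim x)
      have "u ((T ^^ N) x) = indicator D x * ((z ^ N * g x) ^ k * cnj (z ^ N * g x) ^ m)"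
        using inv[OF elim(2)] by (simp add: u_def elim(1) indicator_def)
      also have "\<dots> = ((z ^ N) ^ k * cnj (z ^ N) ^ m) * u x"
        by (simp add: u_def power_mult_distrib)
      also have "\<dots> = c * u x" by (simp only: c)
      finally show ?case .
    qed
  qed simp
  also have "\<dots> = c * (\<integral>x. u x \<partial>M)" by simp
  finally have "(1 - c) * (\<integral>x. u x \<partial>M) = 0" by (simp add: algebra_simps)
  moreover have "c \<noteq> 1"
    using nroot by (metis c_def complex_cnj_cancel_iff complex_cnj_one)
  ultimately show ?thesis by (simp add: u_def)
qed

text \<open>The hypothesis says that \<open>g\<close> has the moments of a multiple of the uniform distribution on
  the circle. For a monic polynomial \<open>P\<close> of degree \<open>m\<close> vanishing on \<open>Z\<close>, all terms of
  \<open>P(g) cnj(g)^m\<close> but the leading one then integrate to 0.\<close>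

lemma (in finite_measure) vanishing_moments_bound:
  fixes g \<phi> :: "'a \<Rightarrow> complex"
  assumes g [measurable]: "g \<in> borel_measurable M" and g01: "\<And>x. norm (g x) = 0 \<or> norm (g x) = 1"
    and D [measurable]: "D \<in> sets M"
    and moments: "\<And>k. k < card Z \<Longrightarrow> (\<integral>x. indicator D x * (g x ^ k * cnj (g x) ^ card Z) \<partial>M) = 0"
    and Z: "finite Z" "card Z \<le> d" "\<And>w. w \<in> Z \<Longrightarrow> norm w \<le> 2"
    and \<phi> [measurable]: "\<phi> \<in> borel_measurable M" and \<phi>Z: "\<And>x. x \<in> D \<Longrightarrow> \<phi> x \<in> Z"
  shows "measure M {x \<in> D. g x \<noteq> 0} \<le> 3 ^ d * (\<integral>x. indicator D x * norm (g x - \<phi> x) \<partial>M)"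
proof -
  define m where "m = card Z"
  define P where "P = (\<Prod>w\<in>Z. [:- w, 1:])"
  have deg: "degree P = m" and lead: "coeff P m = 1"
  proof -
    show "degree P = m" unfolding P_def by (subst degree_prod_sum_eq) (auto simp: m_def)
    moreover have "lead_coeff P = 1" unfolding P_def by (subst lead_coeff_prod) simp
    ultimately show "coeff P m = 1" by simp
  qed
  have g1: "norm (g x) \<le> 1" for x using g01[of x] by auto
  have gb: "norm (g x) ^ i \<le> 1" for x i using g1[of x] by (simp add: power_le_one)
  have D_sp: "D \<subseteq> space M" using D by (rule sets.sets_into_space)
  have int_term [simp]: "integrable M (\<lambda>x. indicator D x * (g x ^ i * cnj (g x) ^ m))" for i
  proof (rule integrable_const_bound[where B = 1])
    show "AE x in M. norm (indicator D x * (g x ^ i * cnj (g x) ^ m)) \<le> 1"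
      by (auto simp: indicator_def norm_mult norm_power gb mult_le_one)
  qed measurable
  have bound_P: "norm (poly P (g x)) \<le> 3 ^ d * norm (g x - \<phi> x)" if x: "x \<in> D" for x
  proof -
    have "poly P (g x) = (\<Prod>w\<in>Z. g x - w)" by (simp add: P_def poly_prod)
    then have "norm (poly P (g x)) = (\<Prod>w\<in>Z. norm (g x - w))" by (simp add: prod_norm)
    \<comment> \<open>The factor of the root \<open>\<phi> x\<close> is kept; each of the others is
      at most 1 + 2 = 3, and there are fewer than \<open>d\<close> of them.\<close>
    also have "\<dots> = norm (g x - \<phi> x) * (\<Prod>w\<in>Z - {\<phi> x}. norm (g x - w))"
      using \<phi>Z[OF x] Z(1) by (simp add: prod.remove)
    also have "(\<Prod>w\<in>Z - {\<phi> x}. norm (g x - w)) \<le> (\<Prod>w\<in>Z - {\<phi> x}. 3)"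
    proof (rule prod_mono)
      fix w assume "w \<in> Z - {\<phi> x}"
      then show "0 \<le> norm (g x - w) \<and> norm (g x - w) \<le> 3"
        using norm_triangle_ineq4[of "g x" w] g1[of x] Z(3)[of w] by auto
    qed
    also have "\<dots> \<le> 3 ^ d"
      using Z(2) card_Diff1_le[of Z "\<phi> x"] by (auto intro!: power_increasing)
    finally show ?thesis by (simp add: mult_left_mono mult.commute[of _ "norm (g x - \<phi> x)"])
  qed
  have expand: "indicator D x * (poly P (g x) * cnj (g x) ^ m)
      = (\<Sum>i\<le>m. coeff P i * (indicator D x * (g x ^ i * cnj (g x) ^ m)))" for x
    by (simp only: poly_altdef deg sum_distrib_left sum_distrib_right mult_ac)
  have "(\<integral>x. indicator D x * (poly P (g x) * cnj (g x) ^ m) \<partial>M)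
     = (\<integral>x. (\<Sum>i\<le>m. coeff P i * (indicator D x * (g x ^ i * cnj (g x) ^ m))) \<partial>M)"
    by (simp only: expand)
  also have "\<dots> = (\<Sum>i\<le>m. coeff P i * (\<integral>x. indicator D x * (g x ^ i * cnj (g x) ^ m) \<partial>M))"
    by (subst Bochner_Integration.integral_sum) auto
  also have "\<dots> = (\<Sum>i\<in>{m}. coeff P i * (\<integral>x. indicator D x * (g x ^ i * cnj (g x) ^ m) \<partial>M))"
    by (rule sum.mono_neutral_right) (use moments in \<open>auto simp: m_def\<close>)
  also have "\<dots> = (\<integral>x. indicator D x * (g x ^ m * cnj (g x) ^ m) \<partial>M)"
    by (simp add: lead)
  finally have eq: "(\<integral>x. indicator D x * (poly P (g x) * cnj (g x) ^ m) \<partial>M)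
      = (\<integral>x. indicator D x * (g x ^ m * cnj (g x) ^ m) \<partial>M)" .
  have sq: "g x ^ m * cnj (g x) ^ m = of_real (norm (g x) ^ (2 * m))" for x
    by (simp flip: power_mult_distrib complex_norm_square add: power_mult)
  have int_norm: "integrable M (\<lambda>x. indicator D x * norm (g x - \<phi> x))"
  proof (rule integrable_const_bound[where B = 3])
    show "AE x in M. norm (indicator D x * norm (g x - \<phi> x)) \<le> 3"
    proof (rule AE_I2)
      fix x
      show "norm (indicator D x * norm (g x - \<phi> x)) \<le> 3"
        using norm_triangle_ineq4[of "g x" "\<phi> x"] g1[of x] Z(3)[OF \<phi>Z, of x]
        by (cases "x \<in> D") auto
    qed
  qed simp
  have S: "{x \<in> D. g x \<noteq> 0} \<in> sets M"
  proof -
    have "{x \<in> D. g x \<noteq> 0} = D \<inter> {x \<in> space M. g x \<noteq> 0}" using D_sp by auto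
    also have "\<dots> \<in> sets M" by measurable
    finally show ?thesis .
  qed
  have "measure M {x \<in> D. g x \<noteq> 0} = (\<integral>x. indicator {x \<in> D. g x \<noteq> 0} x \<partial>M)"
    using S by simp
  \<comment> \<open>For \<open>m > 0\<close> the power is the indicator of
    \<open>g x \<noteq> 0\<close>; the inequality also covers \<open>m = 0\<close>, where 0 ^ 0 =
    1.\<close>
  also have "\<dots> \<le> (\<integral>x. indicator D x * norm (g x) ^ (2 * m) \<partial>M)"
  proof (rule integral_mono)
    show "integrable M (indicator {x \<in> D. g x \<noteq> 0} :: 'a \<Rightarrow> real)" using S by (simp add: emeasure_eq_measure)
    show "integrable M (\<lambda>x. indicator D x * norm (g x) ^ (2 * m))"
    proof (rule integrable_const_bound[where B = 1])
      show "AE x in M. norm (indicator D x * norm (g x) ^ (2 * m)) \<le> 1"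
        by (auto simp: indicator_def gb)
    qed measurable
    show "indicator {x \<in> D. g x \<noteq> 0} x \<le> indicator D x * norm (g x) ^ (2 * m)" for x
      using g01[of x] by (auto simp: indicator_def)
  qed
  also have "\<dots> = norm (\<integral>x. indicator D x * (g x ^ m * cnj (g x) ^ m) \<partial>M)"
  proof -
    have "(\<lambda>x. indicator D x * (g x ^ m * cnj (g x) ^ m))
        = (\<lambda>x. complex_of_real (indicator D x * norm (g x) ^ (2 * m)))"
      by (auto simp: sq indicator_def)
    then have "(\<integral>x. indicator D x * (g x ^ m * cnj (g x) ^ m) \<partial>M)
        = of_real (\<integral>x. indicator D x * norm (g x) ^ (2 * m) \<partial>M)"
      by (simp only: integral_complex_of_real)
    then show ?thesis by (simp add: integral_nonneg)
  qed
  also have "\<dots> = norm (\<integral>x. indicator D x * (poly P (g x) * cnj (g x) ^ m) \<partial>M)" by (simp only: eq)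
  also have "\<dots> \<le> (\<integral>x. 3 ^ d * (indicator D x * norm (g x - \<phi> x)) \<partial>M)"
  proof (rule order_trans[OF integral_norm_bound integral_mono])
    show "integrable M (\<lambda>x. norm (indicator D x * (poly P (g x) * cnj (g x) ^ m)))"
    proof (intro integrable_norm)
      show "integrable M (\<lambda>x. indicator D x * (poly P (g x) * cnj (g x) ^ m))"
        unfolding expand by (intro Bochner_Integration.integrable_sum integrable_mult_right int_term)
    qed
    show "integrable M (\<lambda>x. 3 ^ d * (indicator D x * norm (g x - \<phi> x)))"
      using int_norm by simp
    fix x
    show "norm (indicator D x * (poly P (g x) * cnj (g x) ^ m)) \<le> 3 ^ d * (indicator D x * norm (g x - \<phi> x))"
    proof (cases "x \<in> D")
      case True
      have "norm (poly P (g x)) * norm (g x) ^ m \<le> norm (poly P (g x))"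
        using gb[of x m] by (simp add: mult_left_le)
      with bound_P[OF True] True show ?thesis by (simp add: norm_mult norm_power)
    qed simp
  qed
  also have "\<dots> = 3 ^ d * (\<integral>x. indicator D x * norm (g x - \<phi> x) \<partial>M)" by simp
  finally show ?thesis .
qed


text \<open>The constant \<open>3 ^ d\<close> does not depend on \<open>n\<close>. Hence an
  approximation of the eigenfunction may be chosen first, at whatever level \<open>n\<close> it
  needs; the moment bound is then applied on each fibre of \<open>rank n\<close>, where the
  approximation takes at most \<open>d\<close> values.\<close>

lemma (in refining_codes) eigenvalue_root_of_unity:
  fixes T :: "'a \<Rightarrow> 'a" and rank :: "nat \<Rightarrow> 'c \<Rightarrow> nat" and N :: "nat \<Rightarrow> nat"
  assumes T: "T \<in> measurable M M" "distr M M T = M"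
    and N: "\<And>n. N n > 0"
    and rank_inv: "\<And>n x. x \<in> space M \<Longrightarrow> rank n (code n ((T ^^ N n) x)) = rank n (code n x)"
    and few: "\<And>n j. card {c \<in> code n ` space M. rank n c = j} \<le> d"
    and ev: "measurable_eigenvalue T M z"
  shows "\<exists>k>0. z ^ k = 1"
proof (rule ccontr)
  assume "\<not> ?thesis"
  then have nroot: "\<And>k. k > 0 \<Longrightarrow> z ^ k \<noteq> 1" by blast
  obtain f where f [measurable]: "f \<in> borel_measurable M"
    and f2: "integrable M (\<lambda>x. (norm (f x))\<^sup>2)" and fn0: "\<not> (AE x in M. f x = 0)"
    and feig: "AE x in M. f (T x) = z * f x"
    using ev by (auto simp: measurable_eigenvalue_def)
  note T(1)[measurable]
  \<comment> \<open>The L^2 norms of \<open>f\<close> and of \<open>f\<close> composed with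
    \<open>T\<close> agree by invariance of the measure, which forces
    \<open>norm z = 1\<close>.\<close>
  let ?I = "\<integral>x. (norm (f x))\<^sup>2 \<partial>M"
  have "?I = (\<integral>x. (norm (f (T x)))\<^sup>2 \<partial>M)"
    using integral_distr[OF T(1), of "\<lambda>x. (norm (f x))\<^sup>2"] T(2) by simp
  also have "\<dots> = (\<integral>x. (norm z)\<^sup>2 * (norm (f x))\<^sup>2 \<partial>M)"
  proof (rule integral_cong_AE)
    show "AE x in M. (norm (f (T x)))\<^sup>2 = (norm z)\<^sup>2 * (norm (f x))\<^sup>2"
      using feig by eventually_elim (simp add: norm_mult power_mult_distrib)
  qed measurable
  also have "\<dots> = (norm z)\<^sup>2 * ?I" by simp
  finally have "((norm z)\<^sup>2 - 1) * ?I = 0" by (simp add: algebra_simps)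
  moreover have "?I \<noteq> 0"
    using fn0 f2 by (simp add: integral_nonneg_eq_0_iff_AE)
  ultimately have "(norm z)\<^sup>2 = 1" by simp
  then have z: "norm z = 1" using norm_ge_zero[of z] unfolding power2_eq_1_iff by linarith

  \<comment> \<open>Because \<open>norm z = 1\<close>, passing to \<open>sgn\<close> keeps the
    eigenvalue; zeros of \<open>f\<close> stay zeros, and all other values move to the unit
    circle.\<close>
  define g where "g x = sgn (f x)" for x
  have g [measurable]: "g \<in> borel_measurable M" unfolding g_def sgn_div_norm by measurable
  have g01: "norm (g x) = 0 \<or> norm (g x) = 1" for x by (simp add: g_def norm_sgn)
  have geig: "AE x in M. g (T x) = z * g x"
    using feig by eventually_elim (simp add: g_def sgn_mult z sgn_div_norm[of z])
  define A where "A = {x \<in> space M. g x \<noteq> 0}"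
  have A [measurable]: "A \<in> sets M" unfolding A_def by measurable
  have "measure M A \<noteq> 0"
  proof
    assume "measure M A = 0"
    then have "AE x in M. x \<notin> A" by (simp add: prob_eq_0)
    then have "AE x in M. f x = 0" using AE_space by eventually_elim (simp add: A_def g_def sgn_zero_iff)
    with fn0 show False ..
  qed
  then have pos: "measure M A > 0" by (simp add: zero_less_measure_iff)

  have "integrable M g"
  proof (rule integrable_const_bound[where B = 1])
    show "AE x in M. norm (g x) \<le> 1" using g01 by (intro AE_I2) (metis order_refl zero_le_one)
  qed measurable
  then have "approximable g" by (rule integrable_approximable)
  \<comment> \<open>The tolerance is chosen so that the factor \<open>3 ^ d\<close> lost in the
    moment bound still leaves less than \<open>measure M A\<close>.\<close>
  then obtain n \<phi> where \<phi>: "(\<integral>x. norm (g x - \<phi> (code n x)) \<partial>M) < measure M A / 3 ^ d"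
    using pos by (auto elim: approximableE[of g "measure M A / 3 ^ d"])
  \<comment> \<open>A value of modulus above 2 lies at distance more than 1 from \<open>g x\<close>,
    whereas 0 lies at distance at most 1. Truncation does not increase the error and bounds the
    roots by 2.\<close>
  define \<psi> where "\<psi> c = (if norm (\<phi> c) \<le> 2 then \<phi> c else 0)" for c
  have \<psi>2: "norm (\<psi> c) \<le> 2" for c by (simp add: \<psi>_def)
  have [simp]: "integrable M g" by fact
  have "(\<integral>x. norm (g x - \<psi> (code n x)) \<partial>M) \<le> (\<integral>x. norm (g x - \<phi> (code n x)) \<partial>M)"
  proof (rule integral_mono)
    fix x
    show "norm (g x - \<psi> (code n x)) \<le> norm (g x - \<phi> (code n x))"
      using g01[of x] norm_triangle_ineq2[of "\<phi> (code n x)" "g x"]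
      by (auto simp: \<psi>_def norm_minus_commute)
  qed auto
  with \<phi> have small: "(\<integral>x. norm (g x - \<psi> (code n x)) \<partial>M) < measure M A / 3 ^ d" by simp

  define D where "D j = {x \<in> space M. rank n (code n x) = j}" for j
  have D [measurable]: "D j \<in> sets M" for j unfolding D_def by measurable
  define J where "J = rank n ` code n ` space M"
  have fin_J: "finite J" unfolding J_def using finite_codes[of n] by simp
  have TN: "(T ^^ N n) x \<in> space M" if "x \<in> space M" for x
    using measurable_space[of "T ^^ N n" M M x] measure_preserving_funpow[OF T] that by auto
  have bound: "measure M {x \<in> D j. g x \<noteq> 0} \<le> 3 ^ d * (\<integral>x. indicator (D j) x * norm (g x - \<psi> (code n x)) \<partial>M)" for j
  proof (rule vanishing_moments_bound[where Z = "\<psi> ` {c \<in> code n ` space M. rank n c = j}"])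
    let ?Z = "\<psi> ` {c \<in> code n ` space M. rank n c = j}"
    have finC: "finite {c \<in> code n ` space M. rank n c = j}" using finite_codes[of n] by simp
    then show "finite ?Z" by simp
    show "card ?Z \<le> d" using card_image_le[OF finC, of \<psi>] few[of n j] by simp
    show "(\<integral>x. indicator (D j) x * (g x ^ k * cnj (g x) ^ card ?Z) \<partial>M) = 0" if "k < card ?Z" for k
    proof (rule eigenfunction_moment_eq_0[OF T g geig z D])
      show "(T ^^ N n) x \<in> D j \<longleftrightarrow> x \<in> D j" if "x \<in> space M" for x
        using that TN rank_inv by (simp add: D_def)
      show "z ^ (N n * (card ?Z - k)) \<noteq> 1" using that N by (intro nroot) simp
    qed (use that in simp)
  qed (use g01 \<psi>2 in \<open>auto simp: D_def\<close>)
  have int: "integrable M (\<lambda>x. indicator (D j) x * norm (g x - \<psi> (code n x)))" for j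
    using integrable_mult_indicator[OF D, of "\<lambda>x. norm (g x - \<psi> (code n x))"] by simp
  \<comment> \<open>The sets \<open>D j\<close> partition the space, so the local errors add up to
    the global one; with \<open>small\<close> this yields
    \<open>measure M A < measure M A\<close>.\<close>
  have "measure M A = measure M (\<Union>j\<in>J. {x \<in> D j. g x \<noteq> 0})"
    by (rule arg_cong[where f = "measure M"]) (auto simp: A_def D_def J_def)
  also have "\<dots> \<le> (\<Sum>j\<in>J. measure M {x \<in> D j. g x \<noteq> 0})"
    by (rule measure_UNION_le) (use fin_J in \<open>auto simp: D_def\<close>)
  also have "\<dots> \<le> (\<Sum>j\<in>J. 3 ^ d * (\<integral>x. indicator (D j) x * norm (g x - \<psi> (code n x)) \<partial>M))"
    by (intro sum_mono bound)
  also have "\<dots> = 3 ^ d * (\<integral>x. (\<Sum>j\<in>J. indicator (D j) x * norm (g x - \<psi> (code n x))) \<partial>M)"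
    by (subst Bochner_Integration.integral_sum) (simp_all add: int sum_distrib_left)
  also have "(\<integral>x. (\<Sum>j\<in>J. indicator (D j) x * norm (g x - \<psi> (code n x))) \<partial>M)
      = (\<integral>x. norm (g x - \<psi> (code n x)) \<partial>M)"
  proof (rule Bochner_Integration.integral_cong)
    fix x assume x: "x \<in> space M"
    have "(\<Sum>j\<in>J. indicator (D j) x :: real) = (\<Sum>j\<in>J. if j = rank n (code n x) then 1 else 0)"
      by (rule sum.cong) (use x in \<open>auto simp: D_def indicator_def\<close>)
    also have "\<dots> = 1" using fin_J x by (simp add: J_def)
    finally show "(\<Sum>j\<in>J. indicator (D j) x * norm (g x - \<psi> (code n x))) = norm (g x - \<psi> (code n x))"
      by (simp flip: sum_distrib_right)
  qed simp
  also have "3 ^ d * \<dots> < measure M A" using small by (simp add: field_simps)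
  finally show False by simp
qed

section \<open>The odometer factor of a Toeplitz type diagram\<close>

text \<open>The position of \<open>e\<close>, counted from 0, among the edges into its end-point. It
  serves as a digit.\<close>

definition edge_rank :: "'e bratteli \<Rightarrow> 'e \<Rightarrow> nat" where
  "edge_rank B e = card {f. (f, e) \<in> ord_rel B \<and> f \<noteq> e}"

text \<open>Vertex 1 is an arbitrary representative: for Toeplitz type all vertices of a level give
  the same number.\<close>

definition indegree :: "'e bratteli \<Rightarrow> nat \<Rightarrow> nat" where
  "indegree B n = card {e \<in> edges B n. tgt B e = (n, 1)}"

text \<open>For Toeplitz type this is the number of paths from the top vertex to any one vertex of
  level \<open>n\<close>.\<close>

definition tower_height :: "'e bratteli \<Rightarrow> nat \<Rightarrow> nat" where
  "tower_height B n = (\<Prod>i<n. indegree B (i + 1))"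

text \<open>A mixed radix number with the edge ranks as digits, least significant first. It is the
  position of the first \<open>n\<close> edges among the finite paths with the same end vertex,
  ordered by the last edge where they differ.\<close>

definition path_rank :: "'e bratteli \<Rightarrow> nat \<Rightarrow> (nat \<Rightarrow> 'e) \<Rightarrow> nat" where
  "path_rank B n x = (\<Sum>i<n. tower_height B i * edge_rank B (x i))"

text \<open>Defined for all sequences of edges, so that a finite prefix can be treated before it is
  extended to an infinite path.\<close>

definition path_vertex :: "'e bratteli \<Rightarrow> (nat \<Rightarrow> 'e) \<Rightarrow> nat \<Rightarrow> nat \<times> nat" where
  "path_vertex B x i = (if i = 0 then (0, 0) else tgt B (x (i - 1)))"

lemma tower_height_simps [simp]: "tower_height B 0 = 1" "tower_height B (Suc n) = tower_height B n * indegree B (Suc n)"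
  by (simp_all add: tower_height_def)

lemma path_rank_simps [simp]:
  "path_rank B 0 x = 0" "path_rank B (Suc n) x = path_rank B n x + tower_height B n * edge_rank B (x n)"
  by (simp_all add: path_rank_def)

lemma path_vertex_simps [simp]: "path_vertex B x 0 = (0, 0)" "path_vertex B x (Suc i) = tgt B (x i)"
  by (simp_all add: path_vertex_def)

lemma path_vertex_cong: "(\<And>i. i < n \<Longrightarrow> x i = y i) \<Longrightarrow> path_vertex B x n = path_vertex B y n"
  by (cases n) auto

lemma path_rank_cong: "(\<And>i. i < n \<Longrightarrow> x i = y i) \<Longrightarrow> path_rank B n x = path_rank B n y"
  by (simp add: path_rank_def)

lemma mem_paths_iff: "x \<in> paths B \<longleftrightarrow> (\<forall>i. x i \<in> edges B (Suc i) \<and> src B (x i) = path_vertex B x i)"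
  by (simp add: paths_def path_vertex_def)

section \<open>Edges of a Toeplitz type diagram\<close>

locale toeplitz_bratteli =
  fixes B :: "'e bratteli"
  assumes ordered: "ordered_bratteli_diagram B" and proper: "properly_ordered B"
    and toeplitz: "toeplitz_diagram B"
begin

lemma diagram: "bratteli_diagram B"
  and order: "partial_order_on (all_edges B) (ord_rel B)"
  and comparable: "\<lbrakk>e \<in> all_edges B; f \<in> all_edges B\<rbrakk> \<Longrightarrow>
    (e, f) \<in> ord_rel B \<or> (f, e) \<in> ord_rel B \<longleftrightarrow> tgt B e = tgt B f"
  using ordered by (auto simp: ordered_bratteli_diagram_def)

lemma edges_finite: "finite (edges B (Suc n))"
  and edge_src: "e \<in> edges B (Suc n) \<Longrightarrow> src B e \<in> level B n"
  and edge_tgt: "e \<in> edges B (Suc n) \<Longrightarrow> tgt B e \<in> level B (Suc n)"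
  and edge_into: "v \<in> level B (Suc n) \<Longrightarrow> \<exists>e \<in> edges B (Suc n). tgt B e = v"
proof -
  have "finite (edges B (Suc n)) \<and>
      (\<forall>e \<in> edges B (Suc n). src B e \<in> level B (Suc n - 1) \<and> tgt B e \<in> level B (Suc n)) \<and>
      (\<forall>v \<in> level B (Suc n). \<exists>e \<in> edges B (Suc n). tgt B e = v)"
    by (rule diagram[unfolded bratteli_diagram_def, THEN conjunct1, THEN spec, THEN mp]) simp
  then show "finite (edges B (Suc n))"
    and "e \<in> edges B (Suc n) \<Longrightarrow> src B e \<in> level B n"
    and "e \<in> edges B (Suc n) \<Longrightarrow> tgt B e \<in> level B (Suc n)"
    and "v \<in> level B (Suc n) \<Longrightarrow> \<exists>e \<in> edges B (Suc n). tgt B e = v"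
    by auto
qed

lemma edges_all: "e \<in> edges B (Suc n) \<Longrightarrow> e \<in> all_edges B"
  unfolding all_edges_def by (rule UN_I[of "Suc n"]) simp_all

lemma edges_same_tgt:
  assumes "e \<in> edges B (Suc n)" "f \<in> all_edges B" "tgt B f = tgt B e"
  shows "f \<in> edges B (Suc n)"
proof -
  obtain m where m: "f \<in> edges B (Suc m)"
  proof -
    obtain k where "1 \<le> k" "f \<in> edges B k" using assms(2) by (auto simp: all_edges_def)
    then show ?thesis using that[of "k - 1"] by simp
  qed
  have "m = n" using edge_tgt[OF assms(1)] edge_tgt[OF m] assms(3) by (auto simp: level_def)
  with m show ?thesis by simp
qed

text \<open>For an edge \<open>e\<close> these are exactly the edges comparable with it, so the
  order is linear on them.\<close>

definition siblings :: "'e \<Rightarrow> 'e set" where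
  "siblings e = {f \<in> all_edges B. tgt B f = tgt B e}"

lemma siblings_eq: "e \<in> edges B (Suc n) \<Longrightarrow> siblings e = {f \<in> edges B (Suc n). tgt B f = tgt B e}"
  by (auto simp: siblings_def intro: edges_all edges_same_tgt[of e n])

lemma finite_siblings: "e \<in> edges B (Suc n) \<Longrightarrow> finite (siblings e)"
  by (simp add: siblings_eq edges_finite)

text \<open>The Toeplitz condition enters here: it compares the end-point of \<open>e\<close> with
  the reference vertex \<open>(Suc n, 1)\<close>, which exists because the level is
  nonempty.\<close>

lemma card_siblings:
  assumes e: "e \<in> edges B (Suc n)"
  shows "card (siblings e) = indegree B (Suc n)"
proof -
  have t: "tgt B e \<in> level B (Suc n)" by (rule edge_tgt[OF e])
  then have "(Suc n, 1) \<in> level B (Suc n)" by (auto simp: level_def)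
  have "card {f \<in> edges B (Suc n). tgt B f = tgt B e} = indegree B (Suc n)"
    unfolding indegree_def using t \<open>(Suc n, 1) \<in> level B (Suc n)\<close>
    by (intro toeplitz[unfolded toeplitz_diagram_def, rule_format]) auto
  then show ?thesis by (simp add: siblings_eq[OF e])
qed

section \<open>Ranks in the order of the edges into a vertex\<close>

lemma refl_ord: "e \<in> all_edges B \<Longrightarrow> (e, e) \<in> ord_rel B"
  and trans_ord: "\<lbrakk>(e, f) \<in> ord_rel B; (f, g) \<in> ord_rel B\<rbrakk> \<Longrightarrow> (e, g) \<in> ord_rel B"
  and antisym_ord: "\<lbrakk>(e, f) \<in> ord_rel B; (f, e) \<in> ord_rel B\<rbrakk> \<Longrightarrow> e = f"
  and ord_edges: "(e, f) \<in> ord_rel B \<Longrightarrow> e \<in> all_edges B \<and> f \<in> all_edges B"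
  using refl_onD[OF partial_order_onD(1)[OF order]] transD[OF partial_order_onD(2)[OF order]]
    antisymD[OF partial_order_onD(3)[OF order]] partial_order_onD(4)[OF order]
  by blast+

lemma ord_siblings: "(e, f) \<in> ord_rel B \<Longrightarrow> e \<in> siblings f \<and> f \<in> siblings e"
  using comparable[of e f] ord_edges[of e f] by (auto simp: siblings_def)

text \<open>By transitivity the strict lower set of \<open>e\<close> lies in that of
  \<open>f\<close>; the inclusion is proper because \<open>e\<close> belongs only to the
  latter.\<close>

lemma edge_rank_strict:
  assumes f: "f \<in> edges B (Suc n)" and le: "(e, f) \<in> ord_rel B" "e \<noteq> f"
  shows "edge_rank B e < edge_rank B f"
  unfolding edge_rank_def
proof (rule psubset_card_mono)
  show "finite {g. (g, f) \<in> ord_rel B \<and> g \<noteq> f}"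
    by (rule finite_subset[OF _ finite_siblings[OF f]]) (use ord_siblings in auto)
  show "{g. (g, e) \<in> ord_rel B \<and> g \<noteq> e} \<subset> {g. (g, f) \<in> ord_rel B \<and> g \<noteq> f}"
    using le trans_ord antisym_ord by blast
qed

lemma ord_iff_edge_rank:
  assumes e: "e \<in> edges B (Suc n)" and f: "f \<in> siblings e"
  shows "(e, f) \<in> ord_rel B \<longleftrightarrow> edge_rank B e \<le> edge_rank B f"
proof -
  have f': "f \<in> edges B (Suc n)" "tgt B f = tgt B e" using f siblings_eq[OF e] by auto
  show ?thesis
    using edge_rank_strict[OF f'(1), of e] edge_rank_strict[OF e, of f] comparable[of e f] f'
      edges_all[OF e] edges_all[OF f'(1)] refl_ord
    by (metis leD nat_less_le order_refl)
qed

lemma edge_rank_inj: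
  assumes e: "e \<in> edges B (Suc n)" and f: "f \<in> siblings e" and eq: "edge_rank B e = edge_rank B f"
  shows "e = f"
proof -
  have f': "f \<in> edges B (Suc n)" "e \<in> siblings f" using f siblings_eq[OF e] e siblings_eq by auto
  show ?thesis
    using ord_iff_edge_rank[OF e f] ord_iff_edge_rank[OF f'] eq antisym_ord by auto
qed

text \<open>The ranks are pairwise different and less than the number of siblings, so they exhaust
  the digits to the base \<open>indegree B (Suc n)\<close>.\<close>

lemma edge_rank_bij:
  assumes e: "e \<in> edges B (Suc n)"
  shows "bij_betw (edge_rank B) (siblings e) {..<indegree B (Suc n)}"
proof -
  have inj: "inj_on (edge_rank B) (siblings e)"
  proof (rule inj_onI)
    fix f g assume "f \<in> siblings e" "g \<in> siblings e" "edge_rank B f = edge_rank B g"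
    then show "f = g"
      using edge_rank_inj[of f n g] siblings_eq[OF e] siblings_eq[of f n] by auto
  qed
  have "edge_rank B ` siblings e \<subseteq> {..<indegree B (Suc n)}"
  proof clarify
    fix f assume f: "f \<in> siblings e"
    then have f': "f \<in> edges B (Suc n)" using siblings_eq[OF e] by auto
    have "edge_rank B f < card (siblings f)"
      unfolding edge_rank_def
      by (rule psubset_card_mono[OF finite_siblings[OF f']])
        (use ord_siblings edges_all[OF f'] in \<open>auto simp: siblings_def\<close>)
    then show "edge_rank B f < indegree B (Suc n)" by (simp add: card_siblings[OF f'])
  qed
  then have "edge_rank B ` siblings e = {..<indegree B (Suc n)}"
    using inj by (intro card_subset_eq) (auto simp: card_image card_siblings[OF e])
  with inj show ?thesis by (simp add: bij_betw_def)
qed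

lemma edge_self_sibling: "e \<in> edges B (Suc n) \<Longrightarrow> e \<in> siblings e"
  by (simp add: siblings_def edges_all)

lemma edge_rank_less: "e \<in> edges B (Suc n) \<Longrightarrow> edge_rank B e < indegree B (Suc n)"
  using edge_rank_bij[of e n] edge_self_sibling[of e n] by (auto simp: bij_betw_def)

lemma edge_of_rank:
  assumes "e \<in> edges B (Suc n)" "k < indegree B (Suc n)"
  obtains f where "f \<in> siblings e" "edge_rank B f = k"
  using bij_betw_imp_surj_on[OF edge_rank_bij[OF assms(1)]] assms(2) by (metis imageE lessThan_iff)

lemma max_edge_iff:
  assumes e: "e \<in> edges B (Suc n)"
  shows "max_edge B e \<longleftrightarrow> Suc (edge_rank B e) = indegree B (Suc n)"
proof
  assume max: "max_edge B e"
  show "Suc (edge_rank B e) = indegree B (Suc n)"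
  proof (rule ccontr)
    assume "\<not> ?thesis"
    then have "Suc (edge_rank B e) < indegree B (Suc n)" using edge_rank_less[OF e] by simp
    then obtain f where f: "f \<in> siblings e" "edge_rank B f = Suc (edge_rank B e)"
      using edge_of_rank[OF e] by blast
    then have "(e, f) \<in> ord_rel B" using ord_iff_edge_rank[OF e] by simp
    then show False using max f by (auto simp: max_edge_def)
  qed
next
  assume eq: "Suc (edge_rank B e) = indegree B (Suc n)"
  show "max_edge B e" unfolding max_edge_def
  proof (intro allI impI)
    fix f assume le: "(e, f) \<in> ord_rel B"
    then have f: "f \<in> siblings e" "f \<in> edges B (Suc n)" using ord_siblings siblings_eq[OF e] by auto
    then show "f = e"
      using edge_rank_less[OF f(2)] edge_rank_inj[OF e f(1)] ord_iff_edge_rank[OF e f(1)] le eq by simp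
  qed
qed

lemma min_edge_iff:
  assumes e: "e \<in> edges B (Suc n)"
  shows "min_edge B e \<longleftrightarrow> edge_rank B e = 0"
proof -
  have "finite {f. (f, e) \<in> ord_rel B \<and> f \<noteq> e}"
    by (rule finite_subset[OF _ finite_siblings[OF e]]) (use ord_siblings in auto)
  then show ?thesis by (auto simp: min_edge_def edge_rank_def)
qed

text \<open>The sibling whose rank is larger by 1 fits the description in \<open>succ_edge\<close>,
  and antisymmetry makes it the only one.\<close>

lemma succ_edge:
  assumes e: "e \<in> edges B (Suc n)" and nmax: "\<not> max_edge B e"
  shows "succ_edge B e \<in> edges B (Suc n)" "tgt B (succ_edge B e) = tgt B e"
    "edge_rank B (succ_edge B e) = Suc (edge_rank B e)"
proof -
  have "Suc (edge_rank B e) < indegree B (Suc n)"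
    using nmax edge_rank_less[OF e] by (simp add: max_edge_iff[OF e])
  then obtain f where f: "f \<in> siblings e" "edge_rank B f = Suc (edge_rank B e)"
    using edge_of_rank[OF e] by blast
  have f': "f \<in> edges B (Suc n)" "tgt B f = tgt B e" using f siblings_eq[OF e] by auto
  have ef: "(e, f) \<in> ord_rel B" "f \<noteq> e" using f ord_iff_edge_rank[OF e] by auto
  have least: "(f, g) \<in> ord_rel B" if "(e, g) \<in> ord_rel B" "g \<noteq> e" for g
  proof -
    have g: "g \<in> siblings e" using that ord_siblings by auto
    then have g': "g \<in> edges B (Suc n)" "g \<in> siblings f"
      using siblings_eq[OF e] f'(2) by (auto simp: siblings_def)
    have "edge_rank B e < edge_rank B g" using edge_rank_strict[OF g'(1) that(1)] that(2) by simp
    then show ?thesis using ord_iff_edge_rank[OF f'(1) g'(2)] f(2) by simp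
  qed
  have "succ_edge B e = f"
    unfolding succ_edge_def
    by (rule the_equality) (use ef least antisym_ord in blast)+
  then show "succ_edge B e \<in> edges B (Suc n)" "tgt B (succ_edge B e) = tgt B e"
    "edge_rank B (succ_edge B e) = Suc (edge_rank B e)"
    using f f' by auto
qed

section \<open>Paths and the Vershik map\<close>

lemma path_edge: "x \<in> paths B \<Longrightarrow> x i \<in> edges B (Suc i)"
  and path_src: "x \<in> paths B \<Longrightarrow> src B (x i) = path_vertex B x i"
  by (simp_all add: mem_paths_iff)

lemma path_vertex_level: "x \<in> paths B \<Longrightarrow> path_vertex B x n \<in> level B n"
  using path_edge edge_tgt by (cases n) (auto simp: level_def)

text \<open>Paths are read off backwards: the end vertex and the rank of the last edge determine the
  last edge, hence its source.\<close>

lemma path_prefix_unique: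
  assumes x: "x \<in> paths B" and y: "y \<in> paths B"
    and "\<And>i. i < n \<Longrightarrow> edge_rank B (x i) = edge_rank B (y i)"
    and "path_vertex B x n = path_vertex B y n"
  shows "\<forall>i<n. x i = y i"
  using assms(3,4)
proof (induction n)
  case (Suc n)
  have "y n \<in> siblings (x n)"
    using Suc.prems(2) path_edge[OF y, of n] edges_all by (simp add: siblings_def)
  then have eq: "x n = y n"
    using edge_rank_inj[OF path_edge[OF x]] Suc.prems(1) by blast
  then have "path_vertex B x n = path_vertex B y n"
    using path_src[OF x] path_src[OF y] by metis
  with Suc eq show ?case by (auto simp: less_Suc_eq)
qed simp

text \<open>Built backwards from \<open>v\<close>: an edge of rank 0 into \<open>v\<close> is
  chosen, then one into its source, and so on. This supplies the initial segment of an image under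
  the Vershik map.\<close>

lemma minimal_prefix_exists:
  assumes "v \<in> level B n"
  shows "\<exists>p. (\<forall>i<n. p i \<in> edges B (Suc i) \<and> src B (p i) = path_vertex B p i \<and> edge_rank B (p i) = 0)
    \<and> path_vertex B p n = v"
  using assms
proof (induction n arbitrary: v)
  case 0
  then show ?case by (auto simp: level_def)
next
  case (Suc n)
  obtain e where e: "e \<in> edges B (Suc n)" "tgt B e = v" using edge_into[OF Suc.prems] by auto
  have "0 < indegree B (Suc n)" using edge_rank_less[OF e(1)] by simp
  then obtain f where f: "f \<in> siblings e" "edge_rank B f = 0" using edge_of_rank[OF e(1)] by blast
  have f': "f \<in> edges B (Suc n)" "tgt B f = v" using f siblings_eq[OF e(1)] e(2) by auto
  obtain p where p: "\<forall>i<n. p i \<in> edges B (Suc i) \<and> src B (p i) = path_vertex B p i \<and> edge_rank B (p i) = 0"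
    "path_vertex B p n = src B f"
    using Suc.IH[OF edge_src[OF f'(1)]] by blast
  define q where "q i = (if i = n then f else p i)" for i
  have "path_vertex B q i = path_vertex B p i" if "i \<le> n" for i
    by (rule path_vertex_cong) (use that in \<open>auto simp: q_def\<close>)
  then have "\<forall>i<Suc n. q i \<in> edges B (Suc i) \<and> src B (q i) = path_vertex B q i \<and> edge_rank B (q i) = 0"
    using p f f'(1) by (auto simp: less_Suc_eq q_def)
  moreover have "path_vertex B q (Suc n) = v" using f'(2) by (simp add: q_def)
  ultimately show ?case by blast
qed

lemma min_path: "min_path B \<in> paths B" "min_edge B (min_path B i)"
proof -
  have "\<exists>!x. x \<in> paths B \<and> (\<forall>i. min_edge B (x i))" using proper by (simp add: properly_ordered_def)
  from theI'[OF this] show "min_path B \<in> paths B" "min_edge B (min_path B i)"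
    by (simp_all add: min_path_def)
qed

lemma vershik_max:
  assumes x: "x \<in> paths B" and max: "\<forall>i. max_edge B (x i)"
  shows "vershik B x \<in> paths B" "edge_rank B (vershik B x i) = 0"
  using max min_path min_edge_iff[OF path_edge[OF min_path(1)]] by (simp_all add: vershik_def)

text \<open>The description in \<open>vershik\<close> is realised by an explicit path: a minimal
  prefix, the successor edge, the tail of \<open>x\<close>. Any other candidate agrees with it from
  \<open>k\<close> on, and below \<open>k\<close> it has edges of rank 0 leading to the same vertex,
  so \<open>path_prefix_unique\<close> applies.\<close>

lemma vershik_nonmax:
  assumes x: "x \<in> paths B" and nmax: "\<not> max_edge B (x k)" and max: "\<forall>i<k. max_edge B (x i)"
  shows "vershik B x \<in> paths B" "\<forall>i<k. edge_rank B (vershik B x i) = 0"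
    "edge_rank B (vershik B x k) = Suc (edge_rank B (x k))" "\<forall>i>k. vershik B x i = x i"
proof -
  have k: "(LEAST i. \<not> max_edge B (x i)) = k"
    by (rule Least_equality) (use nmax max in \<open>auto simp: not_less[symmetric]\<close>)
  define s where "s = succ_edge B (x k)"
  note s = succ_edge[OF path_edge[OF x] nmax, folded s_def]
  obtain p where p: "\<forall>i<k. p i \<in> edges B (Suc i) \<and> src B (p i) = path_vertex B p i \<and> edge_rank B (p i) = 0"
    "path_vertex B p k = src B s"
    using minimal_prefix_exists[OF edge_src[OF s(1)]] by blast
  define y where "y i = (if i < k then p i else if i = k then s else x i)" for i
  \<comment> \<open>The successor has the same end-point as \<open>x k\<close>, so from level
    \<open>k + 1\<close> on the vertices are those of \<open>x\<close> and its tail can be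
    kept.\<close>
  have pv: "path_vertex B y i = (if i \<le> k then path_vertex B p i else path_vertex B x i)" for i
    by (cases i) (auto simp: y_def s(2))
  have y: "y \<in> paths B"
    using p s path_edge[OF x] path_src[OF x] by (auto simp: mem_paths_iff pv) (auto simp: y_def)
  have ymin: "\<forall>i<k. edge_rank B (y i) = 0" using p by (simp add: y_def)
  then have "\<forall>i<k. min_edge B (y i)" using min_edge_iff[OF path_edge[OF y]] by simp
  have "(THE y. y \<in> paths B \<and> (\<forall>i<k. min_edge B (y i)) \<and> y k = s \<and> (\<forall>i>k. y i = x i)) = y"
  proof (rule the_equality)
    show "y \<in> paths B \<and> (\<forall>i<k. min_edge B (y i)) \<and> y k = s \<and> (\<forall>i>k. y i = x i)"
      using y \<open>\<forall>i<k. min_edge B (y i)\<close> by (auto simp: y_def)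
    fix w assume w: "w \<in> paths B \<and> (\<forall>i<k. min_edge B (w i)) \<and> w k = s \<and> (\<forall>i>k. w i = x i)"
    have wk: "w k = y k" using w by (simp add: y_def)
    have "\<forall>i<k. w i = y i"
    proof (rule path_prefix_unique)
      show "path_vertex B w k = path_vertex B y k"
        using path_src[OF y, of k] path_src[of w k] w wk by simp
      show "edge_rank B (w i) = edge_rank B (y i)" if "i < k" for i
        using that ymin w min_edge_iff[OF path_edge[of w i]] by simp
    qed (use w y in auto)
    then show "w = y" using w wk by (auto simp: fun_eq_iff y_def not_less_iff_gr_or_eq)
  qed
  then have eq: "vershik B x = y" using nmax by (auto simp: vershik_def k s_def)
  show "vershik B x \<in> paths B" "\<forall>i<k. edge_rank B (vershik B x i) = 0"
    "edge_rank B (vershik B x k) = Suc (edge_rank B (x k))" "\<forall>i>k. vershik B x i = x i"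
    using y ymin s(3) by (simp_all add: eq y_def)
qed

lemma first_nonmax:
  fixes x :: "nat \<Rightarrow> 'e"
  assumes "\<not> (\<forall>i. max_edge B (x i))"
  obtains k where "\<not> max_edge B (x k)" "\<forall>i<k. max_edge B (x i)"
  using assms exists_least_iff[of "\<lambda>i. \<not> max_edge B (x i)"] by auto

lemma vershik_path:
  assumes x: "x \<in> paths B"
  shows "vershik B x \<in> paths B"
proof (cases "\<forall>i. max_edge B (x i)")
  case True
  then show ?thesis by (rule vershik_max(1)[OF x])
next
  case False
  then obtain k where "\<not> max_edge B (x k)" "\<forall>i<k. max_edge B (x i)" by (rule first_nonmax)
  then show ?thesis by (rule vershik_nonmax(1)[OF x])
qed

section \<open>Mixed radix expansions and the odometer\<close>

lemma path_rank_less: "x \<in> paths B \<Longrightarrow> path_rank B n x < tower_height B n"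
proof (induction n)
  case (Suc n)
  have "path_rank B (Suc n) x < tower_height B n * Suc (edge_rank B (x n))" using Suc by simp
  also have "\<dots> \<le> tower_height B (Suc n)"
    using mult_le_mono2[OF Suc_leI[OF edge_rank_less[OF path_edge[OF Suc.prems, of n]]], of "tower_height B n"]
    by simp
  finally show ?case .
qed simp

lemma tower_height_pos: "x \<in> paths B \<Longrightarrow> tower_height B n > 0"
  using path_rank_less[of x n] by simp

text \<open>Remainder and quotient by \<open>tower_height B n\<close> recover the lower digits and
  the last one, so the expansion is unique.\<close>

lemma path_rank_inj:
  assumes x: "x \<in> paths B" and y: "y \<in> paths B" and "path_rank B n x = path_rank B n y"
  shows "\<forall>i<n. edge_rank B (x i) = edge_rank B (y i)"
  using assms(3)
proof (induction n)
  case (Suc n)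
  let ?h = "tower_height B n"
  have digits: "path_rank B n w = path_rank B (Suc n) w mod ?h" "edge_rank B (w n) = path_rank B (Suc n) w div ?h"
    if "w \<in> paths B" for w
    using path_rank_less[OF that, of n] by simp_all
  have "path_rank B n x = path_rank B n y"
    unfolding digits(1)[OF x] digits(1)[OF y] Suc.prems ..
  moreover have "edge_rank B (x n) = edge_rank B (y n)"
    unfolding digits(2)[OF x] digits(2)[OF y] Suc.prems ..
  ultimately show ?case using Suc.IH by (simp add: less_Suc_eq)
qed simp

lemma path_rank_maximal:
  assumes x: "x \<in> paths B" and "\<forall>i<n. max_edge B (x i)"
  shows "Suc (path_rank B n x) = tower_height B n"
  using assms(2)
proof (induction n)
  case (Suc n)
  have "Suc (path_rank B (Suc n) x) = tower_height B n * Suc (edge_rank B (x n))" using Suc by simp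
  also have "\<dots> = tower_height B (Suc n)"
    using Suc.prems max_edge_iff[OF path_edge[OF x]] by simp
  finally show ?case .
qed simp

text \<open>The Vershik map acts on the digits \<open>edge_rank B (x i)\<close> as the odometer.\<close>

lemma path_rank_vershik:
  assumes x: "x \<in> paths B"
  shows "path_rank B n (vershik B x) = Suc (path_rank B n x) mod tower_height B n"
proof (cases "\<forall>i<n. max_edge B (x i)")
  case True
  \<comment> \<open>The carry runs through all of the first \<open>n\<close> digits: either
    \<open>x\<close> is the maximal path, or its first non-maximal edge is at position
    \<open>n\<close> or later.\<close>
  have "edge_rank B (vershik B x i) = 0" if i: "i < n" for i
  proof (cases "\<forall>i. max_edge B (x i)")
    case True
    then show ?thesis using vershik_max(2)[OF x] by simp
  next
    case False
    then obtain k where k: "\<not> max_edge B (x k)" "\<forall>i<k. max_edge B (x i)"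
      by (rule first_nonmax)
    have "n \<le> k" using True k(1) by (auto simp: not_less[symmetric])
    then show ?thesis using vershik_nonmax(2)[OF x k] i by simp
  qed
  then have "path_rank B n (vershik B x) = 0" by (simp add: path_rank_def)
  then show ?thesis using path_rank_maximal[OF x True] by simp
next
  case False
  then obtain k where k: "\<not> max_edge B (x k)" "\<forall>i<k. max_edge B (x i)"
    using first_nonmax by blast
  have "k < n" using False k(2) by (meson le_less_trans not_less)
  note v = vershik_nonmax[OF x k]
  \<comment> \<open>The carry stops at \<open>k\<close>: the lower digits drop from their maxima to
    0 while digit \<open>k\<close> grows by 1, a net change of 1. Later digits stay the
    same.\<close>
  have "path_rank B m (vershik B x) = Suc (path_rank B m x)" if "Suc k \<le> m" for m
    using that
  proof (induction m rule: dec_induct)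
    case base
    have "path_rank B k (vershik B x) = 0" using v(2) by (simp add: path_rank_def)
    then show ?case using v(3) path_rank_maximal[OF x k(2)] by simp
  next
    case (step m)
    then show ?case using v(4) by simp
  qed
  then have "path_rank B n (vershik B x) = Suc (path_rank B n x)" using \<open>k < n\<close> by simp
  then show ?thesis using path_rank_less[OF vershik_path[OF x], of n] by simp
qed

lemma vershik_funpow_path: "x \<in> paths B \<Longrightarrow> (vershik B ^^ m) x \<in> paths B"
  by (induction m) (auto simp: vershik_path)

text \<open>For \<open>m = tower_height B n\<close> the rank returns to its value, which makes the
  sets of constant rank invariant under that iterate.\<close>

lemma path_rank_vershik_funpow:
  assumes x: "x \<in> paths B"
  shows "path_rank B n ((vershik B ^^ m) x) = (path_rank B n x + m) mod tower_height B n"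
proof (induction m)
  case 0
  show ?case using path_rank_less[OF x] by simp
next
  case (Suc m)
  then show ?case by (simp add: path_rank_vershik[OF vershik_funpow_path[OF x]] mod_Suc_eq)
qed

section \<open>Cylinders and finite prefixes\<close>

lemma topspace_path_space: "topspace (path_space B) = paths B"
  by (auto simp: path_space_def cylinder_def)

lemma openin_cylinder: "p \<in> paths B \<Longrightarrow> openin (path_space B) (cylinder B n p)"
  by (auto simp: path_space_def intro!: topology_generated_by_Basis)

text \<open>Longer cylinders around \<open>x\<close> are smaller, so a finite intersection of basic
  sets containing \<open>x\<close> still contains one.\<close>

lemma open_contains_cylinder:
  assumes "openin (path_space B) U" "x \<in> U"
  shows "\<exists>n. cylinder B n x \<subseteq> U"
  using openin_topology_generated_by[OF assms(1)[unfolded path_space_def]] assms(2)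
proof (induction rule: generate_topology_on.induct)
  case (Int a b)
  then obtain n m where "cylinder B n x \<subseteq> a" "cylinder B m x \<subseteq> b" by auto
  moreover have "cylinder B (max n m) x \<subseteq> cylinder B n x \<inter> cylinder B m x"
    by (auto simp: cylinder_def)
  ultimately show ?case by blast
next
  case (Basis s)
  then obtain n p where "s = cylinder B n p" by auto
  with Basis(2) have "cylinder B n x \<subseteq> s" by (auto simp: cylinder_def)
  then show ?case ..
qed blast+

text \<open>The list is a name for the cylinder of length \<open>n\<close> around
  \<open>x\<close>.\<close>

definition path_prefix :: "nat \<Rightarrow> (nat \<Rightarrow> 'e) \<Rightarrow> 'e list" where
  "path_prefix n x = map x [0..<n]"

lemma path_prefix_eq_iff: "path_prefix n x = path_prefix n y \<longleftrightarrow> (\<forall>i<n. x i = y i)"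
  by (auto simp: path_prefix_def)

lemma finite_prefixes: "finite (path_prefix n ` paths B)"
proof (rule finite_subset)
  show "path_prefix n ` paths B \<subseteq> {xs. set xs \<subseteq> (\<Union>i<n. edges B (Suc i)) \<and> length xs = n}"
  proof clarify
    fix x assume "x \<in> paths B"
    then show "set (path_prefix n x) \<subseteq> (\<Union>i<n. edges B (Suc i)) \<and> length (path_prefix n x) = n"
      using path_edge[of x] by (auto simp: path_prefix_def)
  qed
  show "finite {xs. set xs \<subseteq> (\<Union>i<n. edges B (Suc i)) \<and> length xs = n}"
    by (rule finite_lists_length_eq) (use edges_finite in auto)
qed

text \<open>The rank determines all digits, so a prefix of given rank is determined by its end
  vertex. The bound is \<open>Suc d\<close> because \<open>n = 0\<close> is included, where
  \<open>d\<close> does not count the top vertex.\<close>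

lemma card_prefixes_of_rank:
  assumes "\<And>n. n \<ge> 1 \<Longrightarrow> nverts B n \<le> d"
  shows "card {path_prefix n x | x. x \<in> paths B \<and> path_rank B n x = j} \<le> Suc d"
proof -
  let ?P = "{x \<in> paths B. path_rank B n x = j}"
  have fin: "finite (level B n)" by (simp add: level_def)
  have "card (path_prefix n ` ?P) \<le> card (level B n)"
  proof (rule card_le_if_inj_on_rel[OF fin])
    \<comment> \<open>The end vertex is attached to a prefix through any path that has this prefix,
      so a relation takes the place of a function.\<close>
    let ?r = "\<lambda>c v. \<exists>x\<in>?P. c = path_prefix n x \<and> v = path_vertex B x n"
    show "\<exists>v. v \<in> level B n \<and> ?r c v" if "c \<in> path_prefix n ` ?P" for c
      using that path_vertex_level by blast
    show "c = c'" if cc: "c \<in> path_prefix n ` ?P" "c' \<in> path_prefix n ` ?P" "v \<in> level B n" "?r c v" "?r c' v" for c c' v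
    proof -
      obtain x y where *: "x \<in> ?P" "y \<in> ?P" "c = path_prefix n x" "c' = path_prefix n y"
        "path_vertex B x n = path_vertex B y n" using cc(4,5) by auto
      then show ?thesis
        using path_prefix_unique[of x y n] path_rank_inj[of x y n] by (auto simp: path_prefix_eq_iff)
    qed
  qed
  also have "\<dots> \<le> Suc d" using assms[of n] by (auto simp: level_def card_cartesian_product)
  also have "path_prefix n ` ?P = {path_prefix n x | x. x \<in> paths B \<and> path_rank B n x = j}" by auto
  finally show ?thesis .
qed

lemma openin_prefix_set: "openin (path_space B) {x \<in> paths B. path_prefix n x \<in> C}"
proof -
  have "{x \<in> paths B. path_prefix n x \<in> C} = (\<Union>x\<in>{x \<in> paths B. path_prefix n x \<in> C}. cylinder B n x)"
  proof (intro equalityI subsetI)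
    fix y assume "y \<in> (\<Union>x\<in>{x \<in> paths B. path_prefix n x \<in> C}. cylinder B n x)"
    then obtain x where x: "path_prefix n x \<in> C" and y: "y \<in> cylinder B n x" by auto
    then have "path_prefix n y = path_prefix n x" by (simp add: cylinder_def path_prefix_eq_iff)
    with x y show "y \<in> {x \<in> paths B. path_prefix n x \<in> C}" by (simp add: cylinder_def)
  qed (auto simp: cylinder_def)
  moreover have "openin (path_space B) (\<Union>x\<in>{x \<in> paths B. path_prefix n x \<in> C}. cylinder B n x)"
    by (intro openin_Union) (auto intro: openin_cylinder)
  ultimately show ?thesis by (simp only:)
qed

text \<open>This makes the rank a function of the code. The entries of the list from
  \<open>n\<close> on are unspecified, but only the first \<open>n\<close> are read.\<close>

lemma path_rank_of_prefix: "path_rank B n ((!) (path_prefix n x)) = path_rank B n x"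
  by (rule path_rank_cong) (simp add: path_prefix_def)

end

section \<open>Rationality of the eigenvalues\<close>

lemma root_of_unity_rational:
  fixes z :: complex
  assumes "z ^ k = 1" "k > 0"
  shows "\<exists>\<alpha>::rat. z = exp (2 * \<i> * of_real pi * of_rat \<alpha>)"
proof -
  obtain j where "z = exp (2 * of_real pi * \<i> * of_nat j / of_nat k)"
    using complex_roots_unity[of k] assms by auto
  then have "z = exp (2 * \<i> * of_real pi * of_rat (of_nat j / of_nat k))"
    by (simp add: of_rat_divide mult_ac)
  then show ?thesis by blast
qed

theorem theorem28:
  fixes X :: "'a topology" and T :: "'a \<Rightarrow> 'a" and \<mu> :: "'a measure" and d :: nat
  assumes "cantor_minimal_system X T"
    and "toeplitz_type_of_rank TYPE('e) X T d"
    and "ergodic_probability X T \<mu>"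
  shows "\<forall>z. measurable_eigenvalue T \<mu> z \<longrightarrow>
           (\<exists>\<alpha>::rat. z = exp (2 * \<i> * of_real pi * of_rat \<alpha>))"
proof (intro allI impI)
  fix z assume ev: "measurable_eigenvalue T \<mu> z"
  obtain B :: "'e bratteli" where B: "given_by X T B" "toeplitz_diagram B"
    and rank: "\<And>n. n \<ge> 1 \<Longrightarrow> nverts B n \<le> d"
    using assms(2) by (auto simp: toeplitz_type_of_rank_def)
  interpret toeplitz_bratteli B
    by standard (use B in \<open>auto simp: given_by_def\<close>)
  obtain h where homeo: "homeomorphic_map (path_space B) X h"
    and conj: "\<And>x. x \<in> paths B \<Longrightarrow> T (h x) = h (vershik B x)"
    using B(1) unfolding given_by_def by metis
  have bij: "bij_betw h (paths B) (topspace X)"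
    using homeo by (simp add: homeomorphic_eq_everything_map bij_betw_def topspace_path_space)
  define g where "g = inv_into (paths B) h"
  have g: "g y \<in> paths B" "h (g y) = y" if "y \<in> topspace X" for y
    using that bij_betw_inv_into[OF bij] bij_betw_inv_into_right[OF bij]
    by (auto simp: g_def bij_betw_def)
  have gh: "h x \<in> topspace X" "g (h x) = x" if "x \<in> paths B" for x
    using that bij bij_betw_inv_into_left[OF bij] by (auto simp: g_def bij_betw_def)
  have Tg: "g ((T ^^ m) y) = (vershik B ^^ m) (g y)" if y: "y \<in> topspace X" for m y
  proof -
    have "(T ^^ m) y = h ((vershik B ^^ m) (g y))"
    proof (induction m)
      case (Suc m)
      then show ?case using conj[OF vershik_funpow_path[OF g(1)[OF y]]] by simp
    qed (simp add: g y)
    then show ?thesis using gh(2) vershik_funpow_path[OF g(1)[OF y]] by simp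
  qed
  define code where "code n y = path_prefix n (g y)" for n y
  have space: "space \<mu> = topspace X" and sets: "sets \<mu> = sigma_sets (topspace X) {U. openin X U}"
    and T: "T \<in> measurable \<mu> \<mu>" "distr \<mu> \<mu> T = \<mu>" and prob: "prob_space \<mu>"
    using assms(3) by (auto simp: ergodic_probability_def)
  have code_image: "{c \<in> code n ` topspace X. P c} = {path_prefix n x | x. x \<in> paths B \<and> P (path_prefix n x)}" for n P
    using g gh by (auto simp: code_def) (metis imageI)
  have code_open: "openin X {y \<in> topspace X. code n y \<in> C}" for n C
  proof -
    have "{y \<in> topspace X. code n y \<in> C} = h ` {x \<in> paths B. path_prefix n x \<in> C}"
      using g gh by (force simp: code_def)
    then show ?thesis
      using homeomorphic_map_openness[OF homeo, of "{x \<in> paths B. path_prefix n x \<in> C}"]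
        openin_prefix_set[of n C] by (simp add: topspace_path_space subset_iff)
  qed
  have refine: "code m x = code m y"
    if "m \<le> n" "code n x = code n y" for m n x y
    using that by (simp add: code_def path_prefix_eq_iff)
  have open_code: "U \<in> sigma_sets (topspace X) {{y \<in> topspace X. code n y \<in> C} | n C. True}"
    if U: "openin X U" for U
  proof -
    \<comment> \<open>\<open>C n\<close> collects the codes whose whole cell lies in
      \<open>U\<close>. Each point of the open set \<open>U\<close> has such a cell for some
      \<open>n\<close>, and the union over \<open>n\<close> is countable.\<close>
    define C where "C n = {c. \<forall>y\<in>topspace X. code n y = c \<longrightarrow> y \<in> U}" for n
    have "U = (\<Union>n. {y \<in> topspace X. code n y \<in> C n})"
    proof (intro equalityI subsetI)
      fix y assume y: "y \<in> U"
      have yX: "y \<in> topspace X" using U y openin_subset by blast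
      define V where "V = {x \<in> paths B. h x \<in> U}"
      have "h ` V = U"
      proof (intro equalityI subsetI)
        fix u assume u: "u \<in> U"
        then have "u \<in> topspace X" using U openin_subset by blast
        then have "g u \<in> V" "u = h (g u)" using g u by (simp_all add: V_def)
        then show "u \<in> h ` V" by blast
      qed (auto simp: V_def)
      then have "openin (path_space B) V"
        using homeomorphic_map_openness[OF homeo, of V] U by (simp add: V_def topspace_path_space subset_iff)
      moreover have "g y \<in> V" using g[OF yX] y by (simp add: V_def)
      ultimately obtain n where n: "cylinder B n (g y) \<subseteq> V" using open_contains_cylinder by blast
      have "u \<in> U" if u: "u \<in> topspace X" "code n u = code n y" for u
      proof -
        have "g u \<in> cylinder B n (g y)"
          using u g by (simp add: code_def path_prefix_eq_iff cylinder_def)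
        then show ?thesis using n g(2)[OF u(1)] by (auto simp: V_def)
      qed
      then show "y \<in> (\<Union>n. {y \<in> topspace X. code n y \<in> C n})" using yX by (auto simp: C_def)
    qed (auto simp: C_def)
    also have "\<dots> \<in> sigma_sets (topspace X) {{y \<in> topspace X. code n y \<in> C} | n C. True}"
      by (intro sigma_sets.Union sigma_sets.Basic) blast
    finally show ?thesis .
  qed
  interpret refining_codes \<mu> code
  proof (intro refining_codes.intro[OF prob] refining_codes_axioms.intro)
    show "finite (code n ` space \<mu>)" for n
      by (rule finite_subset[OF _ finite_prefixes[of n]]) (use g in \<open>auto simp: space code_def\<close>)
    show "sets \<mu> = sigma_sets (space \<mu>) {{x \<in> space \<mu>. code n x \<in> C} | n C. True}"
      unfolding sets space
      by (rule sigma_sets_eqI) (use open_code code_open in \<open>auto intro: sigma_sets.Basic\<close>)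
  qed (use refine in blast)
  have "\<exists>k>0. z ^ k = 1"
  \<comment> \<open>The periods are the tower heights: \<open>tower_height B n\<close> steps add 0
    to the rank modulo that height.\<close>
  proof (rule eigenvalue_root_of_unity[OF T _ _ _ ev])
    show "tower_height B n > 0" for n using tower_height_pos[OF min_path(1)] .
    show "path_rank B n ((!) (code n ((T ^^ tower_height B n) x))) = path_rank B n ((!) (code n x))"
      if "x \<in> space \<mu>" for n x
    proof -
      have x: "x \<in> topspace X" using that by (simp add: space)
      show ?thesis
        using path_rank_vershik_funpow[OF g(1)[OF x], of n "tower_height B n"] path_rank_less[OF g(1)[OF x], of n]
        by (simp add: code_def path_rank_of_prefix Tg[OF x])
    qed
    show "card {c \<in> code n ` space \<mu>. path_rank B n ((!) c) = j} \<le> Suc d" for n j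
      unfolding space code_image path_rank_of_prefix
      by (rule card_prefixes_of_rank) (rule rank)
  qed
  then show "\<exists>\<alpha>::rat. z = exp (2 * \<i> * of_real pi * of_rat \<alpha>)"
    using root_of_unity_rational by blast
qed

end
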